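(* Let $N\ge 1$ and $K\in\mathbb{N}$, let $\nu_1,\dots,\nu_K\in(0,1)$, and let $\alpha_1>-1$. Consider the multi-term equation with all coefficients equal to one, $\sum_{i=1}^K {}_0\mathcal{D}_t^{\nu_i}u(t)=f(t)$, $t\in(0,+\infty)$, $u(0)=0$, and let $S\in\mathbb{R}^{N\times N}$ (row index $k$, column index $n$) be the coefficient matrix of its Petrov-Galerkin discretization, $$S_{kn}=\frac{\Gamma(n+\alpha_1)}{\Gamma(n)}\left[\delta_{kn}+\sum_{j=1}^{K-1}(Q_j)_{kn}\right],\qquad (Q_j)_{kn}=\int_0^\infty \phi_n^{0,1}(t)\,\phi_k^{\nu_{j+1}-\nu_1,2}(t)\,dt=\int_0^\infty e^{-t}L_{n-1}^{(0)}(t)\,L_{k-1}^{(\nu_{j+1}-\nu_1)}(t)\,dt .$$ Then for each $j$, $$(Q_j)_{kn}=\begin{cases}\dfrac{1}{(k-n)!}\displaystyle\prod_{\ell=1}^{k-n}(\nu_{j+1}-\nu_1+\ell-1), & k\ge n,\\[2mm] 0, & k<n,\end{cases}$$ so each $Q_j$ is a lower-triangular Toeplitz matrix. Consequently $S=\tilde S D$, where $\tilde S=I+\sum_{j=1}^{K-1}Q_j$ is a lower-triangular Toeplitz matrix and $D$ is the diagonal matrix with entries $D_{nn}=\Gamma(n+\alpha_1)/\Gamma(n)$, $n=1,\dots,N$. In particular, for $K=2$, $\tilde S=I+Q_1$, and for $K=3$, $\tilde S=I+Q_1+Q_2$.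
   Context: $L_j^{(\beta)}$ ($j=0,1,2,\dots$, $\beta>-1$) denotes the associated Laguerre polynomial of degree $j$, normalized so that $\int_0^\infty t^\beta e^{-t}L_j^{(\beta)}(t)L_m^{(\beta)}(t)\,dt=\frac{\Gamma(j+\beta+1)}{\Gamma(j+1)}\delta_{jm}$. The generalized associated Laguerre functions of the first and second kinds are, for $n,k\ge 1$ and $t>0$, $\phi_n^{\alpha,1}(t)=t^\alpha L_{n-1}^{(\alpha)}(t)$ and $\phi_k^{\beta,2}(t)=e^{-t}L_{k-1}^{(\beta)}(t)$. ${}_0\mathcal{D}_t^\nu u(t)=\frac{1}{\Gamma(1-\nu)}\frac{d}{dt}\int_0^t u(s)(t-s)^{-\nu}\,ds$ is the left-sided Riemann-Liouville derivative of order $\nu\in(0,1)$. $\Gamma$ is the Euler Gamma function, $\delta_{kn}$ the Kronecker delta, $I$ the identity matrix; empty products equal $1$ and empty sums equal $0$. Origin of $S$: one seeks $u_N=\sum_{n=1}^N a_n\phi_n^{\alpha_1,1}$ and tests the equation against $\phi_k^{\alpha_2,2}$, $k=1,\dots,N$, with $\alpha_2=\alpha_1-\nu_1$ and $\alpha_1$ a tuning parameter. Fractional integration by parts and the derivative formulas for the generalized associated Laguerre functions turn the resulting equations into $S\vec a=\vec{\hat f}$, with $\hat f_k=\int_0^\infty f(t)\phi_k^{\alpha_2,2}(t)\,dt$. *)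

theory Defs
  imports
    "HOL-Analysis.Analysis"
    "Jordan_Normal_Form.Matrix"
begin

text \<open>The sign of the normalisation is the usual one: the leading coefficient is
  \<open>(-1) ^ j / fact j\<close>. The orthogonality relation is \<open>laguerre_orthogonality\<close> below.\<close>

definition laguerre :: "real \<Rightarrow> nat \<Rightarrow> real \<Rightarrow> real" where
  "laguerre \<beta> j t =
     (\<Sum>i\<le>j. (-1) ^ i * ((real j + \<beta>) gchoose (j - i)) / fact i * t ^ i)"

lemma alt_binomial_pochhammer:
  fixes x :: real
  shows "m \<le> j \<Longrightarrow>
    (\<Sum>i\<le>j. (-1) ^ i * real (j choose i) * pochhammer (x + real i) m) =
    (if m = j then (-1) ^ j * fact j else 0)"
proof (induction j arbitrary: m x)
  case 0
  then show ?case by simp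
next
  case (Suc j)
  define S where "S = (\<lambda>j m x. \<Sum>i\<le>j. (-1) ^ i * real (j choose i) * pochhammer (x + real i) m)"
  have rec: "S (Suc j) m x = S j m x - S j m (x + 1)"
  proof -
    have "S (Suc j) m x = pochhammer x m +
      (\<Sum>i\<le>j. (-1) ^ Suc i * real (Suc j choose Suc i) * pochhammer (x + real (Suc i)) m)"
      unfolding S_def by (subst sum.atMost_Suc_shift) simp
    also have "(\<Sum>i\<le>j. (-1) ^ Suc i * real (Suc j choose Suc i) * pochhammer (x + real (Suc i)) m) =
      (\<Sum>i\<le>j. (-1) ^ Suc i * real (j choose Suc i) * pochhammer (x + real (Suc i)) m)
      - S j m (x + 1)"
      unfolding S_def sum_subtractf [symmetric]
      by (rule sum.cong) (simp_all add: algebra_simps)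
    also have "pochhammer x m +
       ((\<Sum>i\<le>j. (-1) ^ Suc i * real (j choose Suc i) * pochhammer (x + real (Suc i)) m)
      - S j m (x + 1)) =
      (\<Sum>i\<le>Suc j. (-1) ^ i * real (j choose i) * pochhammer (x + real i) m) - S j m (x + 1)"
      by (subst sum.atMost_Suc_shift) simp
    also have "\<dots> = S j m x - S j m (x + 1)"
      by (simp add: S_def)
    finally show ?thesis .
  qed
  show ?case
  proof (cases m)
    case 0
    have "S j 0 x = S j 0 (x + 1)" by (simp add: S_def)
    then show ?thesis using rec 0 by (simp add: S_def)
  next
    case (Suc l)
    have diff: "pochhammer y (Suc l) - pochhammer (y + 1) (Suc l) =
      - real (Suc l) * pochhammer (y + 1) l" for y :: real
      unfolding pochhammer_rec[of y] pochhammer_rec'[of "y + 1"] by (simp add: algebra_simps)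
    have "S j m x - S j m (x + 1) = - real (Suc l) * S j l (x + 1)"
      unfolding S_def sum_subtractf [symmetric] sum_distrib_left
    proof (rule sum.cong)
      fix i assume "i \<in> {..j}"
      show "(-1) ^ i * real (j choose i) * pochhammer (x + real i) m -
        (-1) ^ i * real (j choose i) * pochhammer (x + 1 + real i) m =
        - real (Suc l) * ((-1) ^ i * real (j choose i) * pochhammer (x + 1 + real i) l)"
        using arg_cong[OF diff[of "x + real i"], of "\<lambda>z. (-1) ^ i * real (j choose i) * z"] Suc
        by (simp add: algebra_simps)
    qed simp
    also have "S j l (x + 1) = (if l = j then (-1) ^ j * fact j else 0)"
      using Suc.IH[of l "x + 1"] Suc.prems Suc by (simp add: S_def)
    finally have "S (Suc j) m x = - real (Suc l) * (if l = j then (-1) ^ j * fact j else 0)"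
      using rec by simp
    then have "S (Suc j) m x = (if m = Suc j then (-1) ^ Suc j * fact (Suc j) else 0)"
      using Suc by (cases "l = j") (simp_all add: algebra_simps)
    then show ?thesis by (simp only: S_def)
  qed
qed

lemma has_bochner_integral_powr_exp:
  fixes p :: real
  assumes "p > -1"
  shows "has_bochner_integral lborel
    (\<lambda>t. indicator {0<..} t * (t powr p * exp (- t))) (Gamma (p + 1))"
proof (rule has_bochner_integral_nn_integral)
  have "(\<integral>\<^sup>+t. ennreal (indicator {0<..} t * (t powr p * exp (- t))) \<partial>lborel) =
    (\<integral>\<^sup>+t. ennreal (indicator {0..} t * t powr (p + 1 - 1) / exp t) \<partial>lborel)"
    by (intro nn_integral_cong) (auto simp: indicator_def exp_minus field_simps)
  also have "\<dots> = ennreal (Gamma (p + 1))"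
    using Gamma_conv_nn_integral_real[of "p + 1"] assms by simp
  finally show "(\<integral>\<^sup>+t. ennreal (indicator {0<..} t * (t powr p * exp (- t))) \<partial>lborel) =
    ennreal (Gamma (p + 1))" .
qed (use assms in \<open>auto intro!: Gamma_real_nonneg\<close>)

lemma laguerre_moment:
  assumes \<beta>: "\<beta> > (-1::real)" and m: "m \<le> j"
  shows "(\<Sum>i\<le>j. (-1) ^ i * ((real j + \<beta>) gchoose (j - i)) / fact i *
      Gamma (\<beta> + real m + real i + 1)) =
    (if m = j then (-1) ^ j * Gamma (real j + \<beta> + 1) else 0)"
proof -
  have entry: "(-1) ^ i * ((real j + \<beta>) gchoose (j - i)) / fact i *
      Gamma (\<beta> + real m + real i + 1) =
    Gamma (real j + \<beta> + 1) / fact j *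
      ((-1) ^ i * real (j choose i) * pochhammer (\<beta> + 1 + real i) m)" if i: "i \<le> j" for i
  proof -
    have nz: "Gamma (\<beta> + 1 + real i) > 0" using \<beta> by (intro Gamma_real_pos) simp
    have "(real j + \<beta>) gchoose (j - i) =
      Gamma (real j + \<beta> + 1) / (fact (j - i) * Gamma (\<beta> + 1 + real i))"
    proof -
      have "real j + \<beta> + 1 \<notin> \<int>\<^sub>\<le>\<^sub>0" using \<beta> by (auto elim!: nonpos_Ints_cases)
      moreover have "real j + \<beta> - real (j - i) + 1 = \<beta> + 1 + real i"
        using i by (simp add: of_nat_diff)
      ultimately show ?thesis by (subst gbinomial_Gamma) (simp_all add: add_ac)
    qed
    moreover have "Gamma (\<beta> + real m + real i + 1) =
      pochhammer (\<beta> + 1 + real i) m * Gamma (\<beta> + 1 + real i)"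
    proof -
      have "\<beta> + 1 + real i \<notin> \<int>\<^sub>\<le>\<^sub>0" using \<beta> by (auto elim!: nonpos_Ints_cases)
      then show ?thesis using nz by (subst pochhammer_Gamma) (simp_all add: add_ac)
    qed
    ultimately show ?thesis
      using nz i by (simp add: binomial_fact field_simps)
  qed
  have "(\<Sum>i\<le>j. (-1) ^ i * ((real j + \<beta>) gchoose (j - i)) / fact i *
      Gamma (\<beta> + real m + real i + 1)) =
    Gamma (real j + \<beta> + 1) / fact j *
      (\<Sum>i\<le>j. (-1) ^ i * real (j choose i) * pochhammer (\<beta> + 1 + real i) m)"
    unfolding sum_distrib_left by (intro sum.cong refl entry) simp
  then show ?thesis using alt_binomial_pochhammer[OF m, of "\<beta> + 1"] by simp
qed

lemma has_bochner_integral_laguerre_product: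
  assumes \<beta>: "\<beta> > (-1::real)" and m: "m \<le> j"
  shows "has_bochner_integral lborel
    (\<lambda>t. indicator {0<..} t * (t powr \<beta> * exp (- t) * laguerre \<beta> j t * laguerre \<beta> m t))
    (if j = m then Gamma (real j + \<beta> + 1) / Gamma (real j + 1) else 0)"
proof -
  define c where "c = (\<lambda>j i. (-1) ^ i * ((real j + \<beta>) gchoose (j - i)) / fact i)"
  have "has_bochner_integral lborel
    (\<lambda>t. \<Sum>r\<le>m. \<Sum>i\<le>j. c m r * (c j i *
        (indicator {0<..} t * (t powr (\<beta> + real r + real i) * exp (- t)))))
    (\<Sum>r\<le>m. \<Sum>i\<le>j. c m r * (c j i * Gamma (\<beta> + real r + real i + 1)))"
    using \<beta> by (intro has_bochner_integral_sum has_bochner_integral_mult_right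
        has_bochner_integral_powr_exp) auto
  also have "(\<lambda>t. \<Sum>r\<le>m. \<Sum>i\<le>j. c m r * (c j i *
        (indicator {0<..} t * (t powr (\<beta> + real r + real i) * exp (- t))))) =
    (\<lambda>t. indicator {0<..} t * (t powr \<beta> * exp (- t) * laguerre \<beta> j t * laguerre \<beta> m t))"
  proof
    fix t :: real
    show "(\<Sum>r\<le>m. \<Sum>i\<le>j. c m r * (c j i *
        (indicator {0<..} t * (t powr (\<beta> + real r + real i) * exp (- t))))) =
      indicator {0<..} t * (t powr \<beta> * exp (- t) * laguerre \<beta> j t * laguerre \<beta> m t)"
    proof (cases "t > 0")
      case True
      have "laguerre \<beta> m t * laguerre \<beta> j t =
        (\<Sum>r\<le>m. \<Sum>i\<le>j. (c m r * t ^ r) * (c j i * t ^ i))"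
        unfolding laguerre_def c_def by (simp add: sum_product)
      then have "indicator {0<..} t * (t powr \<beta> * exp (- t) * laguerre \<beta> j t * laguerre \<beta> m t) =
        (\<Sum>r\<le>m. \<Sum>i\<le>j. t powr \<beta> * exp (- t) * ((c m r * t ^ r) * (c j i * t ^ i)))"
        using True by (simp only: sum_distrib_left [symmetric]) (simp add: mult_ac)
      then show ?thesis
        using True by (simp add: powr_add powr_realpow mult_ac)
    qed simp
  qed
  also have "(\<Sum>r\<le>m. \<Sum>i\<le>j. c m r * (c j i * Gamma (\<beta> + real r + real i + 1))) =
    (\<Sum>r\<le>m. c m r * (if r = j then (-1) ^ j * Gamma (real j + \<beta> + 1) else 0))"
    unfolding sum_distrib_left [symmetric] c_def
    using m by (intro sum.cong refl arg_cong[of _ _ "(*) _"] laguerre_moment[OF \<beta>]) simp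
  also have "\<dots> = (if j = m then Gamma (real j + \<beta> + 1) / Gamma (real j + 1) else 0)"
  proof (cases "j = m")
    case True
    have "(\<Sum>r\<le>m. c m r * (if r = j then (-1) ^ j * Gamma (real j + \<beta> + 1) else 0)) =
      c j j * ((-1) ^ j * Gamma (real j + \<beta> + 1))"
      using True by (simp add: if_distrib sum.delta cong: if_cong)
    also have "c j j * ((-1) ^ j * Gamma (real j + \<beta> + 1)) = Gamma (real j + \<beta> + 1) / fact j"
      by (simp add: c_def mult.assoc [symmetric] power_add [symmetric] mult_2 [symmetric])
    finally show ?thesis using True by (simp add: Gamma_fact add.commute)
  next
    case False
    then have "\<And>r. r \<le> m \<Longrightarrow> r \<noteq> j" using m by auto
    then show ?thesis using False by simp
  qed
  finally show ?thesis .
qed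

theorem laguerre_orthogonality:
  assumes "\<beta> > (-1::real)"
  shows "set_integrable lborel {0<..} (\<lambda>t. t powr \<beta> * exp (- t) * laguerre \<beta> j t * laguerre \<beta> m t)"
    and "(LBINT t:{0<..}. t powr \<beta> * exp (- t) * laguerre \<beta> j t * laguerre \<beta> m t) =
      (if j = m then Gamma (real j + \<beta> + 1) / Gamma (real j + 1) else 0)"
proof -
  have "has_bochner_integral lborel
    (\<lambda>t. indicator {0<..} t * (t powr \<beta> * exp (- t) * laguerre \<beta> j t * laguerre \<beta> m t))
    (if j = m then Gamma (real j + \<beta> + 1) / Gamma (real j + 1) else 0)"
  proof (cases "m \<le> j")
    case True
    then show ?thesis using has_bochner_integral_laguerre_product[OF assms] by blast
  next
    case False
    then have "j \<le> m" "j \<noteq> m" by auto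
    then show ?thesis
      using has_bochner_integral_laguerre_product[OF assms, of j m] by (simp add: mult_ac)
  qed
  then show "set_integrable lborel {0<..}
      (\<lambda>t. t powr \<beta> * exp (- t) * laguerre \<beta> j t * laguerre \<beta> m t)"
    and "(LBINT t:{0<..}. t powr \<beta> * exp (- t) * laguerre \<beta> j t * laguerre \<beta> m t) =
      (if j = m then Gamma (real j + \<beta> + 1) / Gamma (real j + 1) else 0)"
    by (auto simp: set_integrable_def set_lebesgue_integral_def has_bochner_integral_iff)
qed

text \<open>Generalized associated Laguerre functions, indexed from 1.\<close>

definition gal_fun1 :: "real \<Rightarrow> nat \<Rightarrow> real \<Rightarrow> real" where
  "gal_fun1 \<alpha> n t = t powr \<alpha> * laguerre \<alpha> (n - 1) t"

definition gal_fun2 :: "real \<Rightarrow> nat \<Rightarrow> real \<Rightarrow> real" where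
  "gal_fun2 \<beta> k t = exp (- t) * laguerre \<beta> (k - 1) t"

text \<open>Mathematical row and column indices run over \<open>1, \<dots>, N\<close>, those of type \<open>mat\<close>
  over \<open>0, \<dots>, N - 1\<close>. The orders are a sequence \<open>\<nu>\<close>, of which only
  \<open>\<nu> 1, \<dots>, \<nu> K\<close> are used.\<close>

definition mat1 :: "nat \<Rightarrow> (nat \<Rightarrow> nat \<Rightarrow> real) \<Rightarrow> real mat" where
  "mat1 N f = mat N N (\<lambda>(r, c). f (r + 1) (c + 1))"

definition Q_mat :: "nat \<Rightarrow> (nat \<Rightarrow> real) \<Rightarrow> nat \<Rightarrow> real mat" where
  "Q_mat N \<nu> j =
     mat1 N (\<lambda>k n. LBINT t:{0<..}. gal_fun1 0 n t * gal_fun2 (\<nu> (j + 1) - \<nu> 1) k t)"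

text \<open>The entries are those obtained after fractional integration by parts: the unreduced pairing
  of \<open>\<Sum>i. D\<^sup>\<nu>\<^sup>i (gal_fun1 \<alpha>\<^sub>1 n)\<close> with \<open>gal_fun2 (\<alpha>\<^sub>1 - \<nu> 1) k\<close> can fail to converge for
  \<open>\<alpha>\<^sub>1\<close> close to \<open>-1\<close>.\<close>

definition S_mat :: "nat \<Rightarrow> nat \<Rightarrow> (nat \<Rightarrow> real) \<Rightarrow> real \<Rightarrow> real mat" where
  "S_mat N K \<nu> \<alpha>\<^sub>1 =
     mat1 N (\<lambda>k n. Gamma (real n + \<alpha>\<^sub>1) / Gamma (real n) *
       ((if k = n then 1 else 0) + (\<Sum>j = 1..K - 1. Q_mat N \<nu> j $$ (k - 1, n - 1))))"

definition S_tilde :: "nat \<Rightarrow> nat \<Rightarrow> (nat \<Rightarrow> real) \<Rightarrow> real mat" where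
  "S_tilde N K \<nu> = 1\<^sub>m N + mat N N (\<lambda>rc. \<Sum>j = 1..K - 1. Q_mat N \<nu> j $$ rc)"

definition D_mat :: "nat \<Rightarrow> real \<Rightarrow> real mat" where
  "D_mat N \<alpha>\<^sub>1 = mat1 N (\<lambda>k n. if k = n then Gamma (real n + \<alpha>\<^sub>1) / Gamma (real n) else 0)"

definition lower_triangular :: "'a :: zero mat \<Rightarrow> bool" where
  "lower_triangular A \<longleftrightarrow> (\<forall>i < dim_row A. \<forall>j < dim_col A. i < j \<longrightarrow> A $$ (i, j) = 0)"

text \<open>Entries are constant along diagonals, that is, \<open>A $$ (i, j)\<close> depends only on \<open>i - j\<close>.\<close>

definition toeplitz :: "'a mat \<Rightarrow> bool" where
  "toeplitz A \<longleftrightarrow>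
     (\<forall>i < dim_row A. \<forall>j < dim_col A. \<forall>i' < dim_row A. \<forall>j' < dim_col A.
        int i - int j = int i' - int j' \<longrightarrow> A $$ (i, j) = A $$ (i', j'))"

end

theory Submission
  imports Defs
begin

text \<open>The Chu-Vandermonde identity gives the connection formula
  \<open>L\<^sub>j\<^sup>(\<^sup>\<alpha>\<^sup>+\<^sup>\<beta>\<^sup>) = (\<Sum>m\<le>j. pochhammer \<beta> (j - m) / fact (j - m) * L\<^sub>m\<^sup>(\<^sup>\<alpha>\<^sup>))\<close>. For
  \<open>\<alpha> = 0\<close> the polynomials on the right are orthonormal for the weight \<open>e\<^sup>-\<^sup>t\<close>, so that
  the integral defining an entry of \<open>Q_mat\<close> picks out a single coefficient, which
  depends on \<open>k - n\<close> only.\<close>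

lemma laguerre_altdef:
  "laguerre \<beta> j t =
     (\<Sum>i\<le>j. pochhammer (\<beta> + real i + 1) (j - i) / fact (j - i) * ((-1) ^ i / fact i * t ^ i))"
  unfolding laguerre_def
  \<comment> \<open>As i \<le> j, the base \<open>real j + \<beta> - real (j - i) + 1\<close> equals
    \<open>\<beta> + real i + 1\<close>. Now j enters only through the length \<open>j - i\<close>,
    the shape a convolution needs.\<close>
  by (intro sum.cong) (auto simp: gbinomial_pochhammer' of_nat_diff add_ac)

text \<open>Chu-Vandermonde for rising factorials: division by n! splits each binomial coefficient
  between the two factors. Formally, it compares coefficients of x^n in (1-x)^(-a) (1-x)^(-b) =
  (1-x)^(-(a+b)).\<close>

lemma pochhammer_fact_convolution:
  fixes a b :: "'a :: field_char_0"
  shows "(\<Sum>p\<le>n. pochhammer a p / fact p * (pochhammer b (n - p) / fact (n - p))) =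
    pochhammer (a + b) n / fact n"
  unfolding pochhammer_binomial_sum sum_divide_distrib
  by (intro sum.cong) (auto simp: binomial_fact field_simps)

lemma laguerre_connection:
  "laguerre (\<alpha> + \<beta>) j t =
     (\<Sum>m\<le>j. pochhammer \<beta> (j - m) / fact (j - m) * laguerre \<alpha> m t)"
proof -
  define e where "e = (\<lambda>i. (-1) ^ i / fact i * t ^ i)"
  define c where "c = (\<lambda>m i. pochhammer (\<alpha> + real i + 1) (m - i) / fact (m - i))"
  define d where "d = (\<lambda>p. pochhammer \<beta> p / fact p :: real)"
  have coeff: "(\<Sum>m\<in>{i..j}. d (j - m) * c m i) =
      pochhammer (\<alpha> + \<beta> + real i + 1) (j - i) / fact (j - i)" if "i \<le> j" for i
  proof -
    \<comment> \<open>With p = j - m the lengths p and m - i add up to j - i, independently of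
      m.\<close>
    have "(\<Sum>m\<in>{i..j}. d (j - m) * c m i) = (\<Sum>p\<le>j - i. d p * c (j - p) i)"
      by (rule sum.reindex_bij_witness[of _ "\<lambda>p. j - p" "\<lambda>m. j - m"]) (use that in auto)
    also have "\<dots> = (\<Sum>p\<le>j - i. pochhammer \<beta> p / fact p *
        (pochhammer (\<alpha> + real i + 1) (j - i - p) / fact (j - i - p)))"
      by (intro sum.cong) (auto simp: c_def d_def add.commute)
    also have "\<dots> = pochhammer (\<beta> + (\<alpha> + real i + 1)) (j - i) / fact (j - i)"
      by (rule pochhammer_fact_convolution)
    finally show ?thesis by (simp add: add_ac)
  qed
  \<comment> \<open>The double sum runs over the triangle i \<le> m \<le> j; the inner range is
    written as a restricted set to fit \<open>sum.swap_restrict\<close>. After the swap,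
    \<open>coeff\<close> evaluates the coefficient of \<open>t ^ i\<close>.\<close>
  have "(\<Sum>m\<le>j. d (j - m) * laguerre \<alpha> m t) =
      (\<Sum>m\<le>j. \<Sum>i | i \<in> {..j} \<and> i \<le> m. d (j - m) * c m i * e i)"
    unfolding laguerre_altdef sum_distrib_left
    by (intro sum.cong) (auto simp: c_def e_def mult.assoc)
  also have "\<dots> = (\<Sum>i\<le>j. \<Sum>m | m \<in> {..j} \<and> i \<le> m. d (j - m) * c m i * e i)"
    by (rule sum.swap_restrict) auto
  also have "\<dots> = (\<Sum>i\<le>j. (\<Sum>m\<in>{i..j}. d (j - m) * c m i) * e i)"
    unfolding sum_distrib_right by (intro sum.cong) auto
  also have "\<dots> = laguerre (\<alpha> + \<beta>) j t"
    unfolding laguerre_altdef[of "\<alpha> + \<beta>"] e_def by (intro sum.cong) (auto simp: coeff)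
  finally show ?thesis by (simp add: d_def)
qed

text \<open>Expanding the second polynomial in the family orthogonal for the weight
  \<open>t powr \<alpha> * exp (- t)\<close> leaves only the term m = n. That term occurs exactly
  when n \<le> k, which is the source of triangularity.\<close>

lemma has_bochner_integral_laguerre_mixed:
  assumes "\<alpha> > -1"
  shows "has_bochner_integral lborel
    (\<lambda>t. indicator {0<..} t * (t powr \<alpha> * exp (- t) * laguerre \<alpha> n t * laguerre (\<alpha> + \<beta>) k t))
    (if n \<le> k then pochhammer \<beta> (k - n) / fact (k - n) *
       (Gamma (real n + \<alpha> + 1) / Gamma (real n + 1)) else 0)"
proof -
  define g where "g = Gamma (real n + \<alpha> + 1) / Gamma (real n + 1)"
  define d where "d = (\<lambda>p. pochhammer \<beta> p / fact p :: real)"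
  have "has_bochner_integral lborel
      (\<lambda>t. \<Sum>m\<le>k. d (k - m) *
        (indicator {0<..} t * (t powr \<alpha> * exp (- t) * laguerre \<alpha> n t * laguerre \<alpha> m t)))
      (\<Sum>m\<le>k. d (k - m) * (if n = m then g else 0))"
    using laguerre_orthogonality[OF assms, of n]
    by (intro has_bochner_integral_sum has_bochner_integral_mult_right)
      (auto simp: has_bochner_integral_iff set_integrable_def set_lebesgue_integral_def g_def)
  also have "(\<lambda>t. \<Sum>m\<le>k. d (k - m) *
        (indicator {0<..} t * (t powr \<alpha> * exp (- t) * laguerre \<alpha> n t * laguerre \<alpha> m t))) =
      (\<lambda>t. indicator {0<..} t *
        (t powr \<alpha> * exp (- t) * laguerre \<alpha> n t * laguerre (\<alpha> + \<beta>) k t))"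
    unfolding laguerre_connection sum_distrib_left d_def by (simp add: mult_ac)
  also have "(\<Sum>m\<le>k. d (k - m) * (if n = m then g else 0)) = (if n \<le> k then d (k - n) * g else 0)"
    by (simp add: if_distrib cong: if_cong)
  finally show ?thesis unfolding d_def g_def .
qed

lemma gal_fun_pairing:
  assumes "n \<ge> 1" and "k \<ge> 1"
  shows "set_integrable lborel {0<..} (\<lambda>t. gal_fun1 0 n t * gal_fun2 \<beta> k t)"
    and "(LBINT t:{0<..}. gal_fun1 0 n t * gal_fun2 \<beta> k t) =
      (if n \<le> k then pochhammer \<beta> (k - n) / fact (k - n) else 0)"
proof -
  have "(\<lambda>t. indicator {0<..} t * (gal_fun1 0 n t * gal_fun2 \<beta> k t)) = (\<lambda>t. indicator {0<..} t *
      (t powr 0 * exp (- t) * laguerre 0 (n - 1) t * laguerre (0 + \<beta>) (k - 1) t))"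
    by (auto simp: gal_fun1_def gal_fun2_def fun_eq_iff)
  \<comment> \<open>The squared norm for \<alpha> = 0, so no factor depending on n alone spoils the
    Toeplitz structure.\<close>
  moreover have "Gamma (real (n - 1) + 0 + 1) / Gamma (real (n - 1) + 1) = 1"
    by (simp add: Gamma_fact add.commute)
  \<comment> \<open>Subtraction is truncated: the equivalence fails for n = 1, k = 0 and the
    equation for n = 0, k = 1.\<close>
  moreover have "n - 1 \<le> k - 1 \<longleftrightarrow> n \<le> k" "k - 1 - (n - 1) = k - n"
    using assms by auto
  ultimately have "has_bochner_integral lborel
      (\<lambda>t. indicator {0<..} t * (gal_fun1 0 n t * gal_fun2 \<beta> k t))
      (if n \<le> k then pochhammer \<beta> (k - n) / fact (k - n) else 0)"
    using has_bochner_integral_laguerre_mixed[of 0 "n - 1" \<beta> "k - 1"]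
    by (simp only: mult_1_right)
  then show "set_integrable lborel {0<..} (\<lambda>t. gal_fun1 0 n t * gal_fun2 \<beta> k t)"
    and "(LBINT t:{0<..}. gal_fun1 0 n t * gal_fun2 \<beta> k t) =
      (if n \<le> k then pochhammer \<beta> (k - n) / fact (k - n) else 0)"
    by (auto simp: set_integrable_def set_lebesgue_integral_def has_bochner_integral_iff)
qed

lemma LBINT_gal_fun_pairing:
  "(LBINT t:{0<..}. gal_fun1 0 n t * gal_fun2 \<beta> k t) =
    (LBINT t:{0<..}. exp (- t) * laguerre 0 (n - 1) t * laguerre \<beta> (k - 1) t)"
  \<comment> \<open>The factor \<open>t powr 0\<close> is 1 on the open half-line; at t = 0 it would
    be 0.\<close>
  by (rule set_lebesgue_integral_cong) (auto simp: gal_fun1_def gal_fun2_def)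

lemma pochhammer_conv_prod_1:
  fixes a :: "'a :: comm_ring_1"
  shows "pochhammer a n = (\<Prod>l = 1..n. a + of_nat l - 1)"
  unfolding pochhammer_prod
  by (rule prod.reindex_bij_witness[of _ "\<lambda>l. l - 1" Suc]) (auto simp: of_nat_diff)

lemma dim_Q_mat [simp]: "dim_row (Q_mat N \<nu> j) = N" "dim_col (Q_mat N \<nu> j) = N"
  by (simp_all add: Q_mat_def mat1_def)

lemma Q_mat_index:
  assumes "r < N" and "c < N"
  shows "Q_mat N \<nu> j $$ (r, c) =
    (if c \<le> r then pochhammer (\<nu> (j + 1) - \<nu> 1) (r - c) / fact (r - c) else 0)"
  using assms by (simp add: Q_mat_def mat1_def gal_fun_pairing)

text \<open>A single profile f of the distance below the diagonal yields both properties, for each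
  \<open>Q_mat\<close> as well as for \<open>S_tilde\<close>.\<close>

lemma lower_triangular_toeplitzI:
  assumes "\<And>r c. r < dim_row A \<Longrightarrow> c < dim_col A \<Longrightarrow>
    A $$ (r, c) = (if c \<le> r then f (r - c) else 0)"
  shows "lower_triangular A" and "toeplitz A"
proof -
  show "lower_triangular A"
    using assms by (auto simp: lower_triangular_def)
  have "(if c \<le> r then f (r - c) else 0) = (if c' \<le> r' then f (r' - c') else 0)"
    if "int r - int c = int r' - int c'" for r c r' c'
  proof -
    \<comment> \<open>The integer difference determines both the side of the diagonal and the
      truncated natural difference.\<close>
    have "c \<le> r \<longleftrightarrow> c' \<le> r'" "r - c = r' - c'" using that by linarith+
    then show ?thesis by simp
  qed
  then show "toeplitz A"
    unfolding toeplitz_def using assms by metis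
qed

lemma Q_mat_lower_triangular_toeplitz:
  "lower_triangular (Q_mat N \<nu> j)" "toeplitz (Q_mat N \<nu> j)"
  using lower_triangular_toeplitzI[of "Q_mat N \<nu> j"
      "\<lambda>d. pochhammer (\<nu> (j + 1) - \<nu> 1) d / fact d"]
  by (simp_all add: Q_mat_index)

lemma dim_S_tilde [simp]: "dim_row (S_tilde N K \<nu>) = N" "dim_col (S_tilde N K \<nu>) = N"
  by (simp_all add: S_tilde_def)

lemma S_tilde_index:
  assumes "r < N" and "c < N"
  shows "S_tilde N K \<nu> $$ (r, c) =
    (if r = c then 1 else 0) + (\<Sum>j = 1..K - 1. Q_mat N \<nu> j $$ (r, c))"
  using assms by (simp add: S_tilde_def)

lemma S_tilde_lower_triangular_toeplitz:
  "lower_triangular (S_tilde N K \<nu>)" "toeplitz (S_tilde N K \<nu>)"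
proof -
  \<comment> \<open>The identity contributes the profile supported at distance 0; profiles
    add.\<close>
  have entry: "S_tilde N K \<nu> $$ (r, c) = (if c \<le> r then (if r - c = 0 then 1 else 0) +
      (\<Sum>j = 1..K - 1. pochhammer (\<nu> (j + 1) - \<nu> 1) (r - c) / fact (r - c)) else 0)"
    if "r < dim_row (S_tilde N K \<nu>)" "c < dim_col (S_tilde N K \<nu>)" for r c
    using that by (auto simp: S_tilde_index Q_mat_index)
  show "lower_triangular (S_tilde N K \<nu>)"
    using entry by (rule lower_triangular_toeplitzI)
  show "toeplitz (S_tilde N K \<nu>)"
    using entry by (rule lower_triangular_toeplitzI)
qed

text \<open>The Gamma quotient in an entry depends on the column only, and multiplying by a diagonal
  matrix on the right scales columns.\<close>

lemma S_mat_factorization: "S_mat N K \<nu> \<alpha> = S_tilde N K \<nu> * D_mat N \<alpha>"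
proof (rule eq_matI)
  fix r c assume "r < dim_row (S_tilde N K \<nu> * D_mat N \<alpha>)"
    and "c < dim_col (S_tilde N K \<nu> * D_mat N \<alpha>)"
  then have rc: "r < N" "c < N" by (simp_all add: D_mat_def mat1_def)
  define g where "g = Gamma (real (c + 1) + \<alpha>) / Gamma (real (c + 1))"
  have "(S_tilde N K \<nu> * D_mat N \<alpha>) $$ (r, c) =
      (\<Sum>i\<in>{0..<N}. S_tilde N K \<nu> $$ (r, i) * (if i = c then g else 0))"
    using rc by (auto simp: scalar_prod_def D_mat_def mat1_def g_def intro!: sum.cong)
  also have "\<dots> = S_tilde N K \<nu> $$ (r, c) * g"
    using rc by (simp add: if_distrib cong: if_cong)
  finally show "S_mat N K \<nu> \<alpha> $$ (r, c) = (S_tilde N K \<nu> * D_mat N \<alpha>) $$ (r, c)"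
    using rc by (simp add: S_mat_def mat1_def S_tilde_index g_def)
qed (simp_all add: S_mat_def D_mat_def mat1_def)

lemma diagonal_D_mat: "diagonal_mat (D_mat N \<alpha>)"
  by (simp add: diagonal_mat_def D_mat_def mat1_def)

theorem mainTheorem1:
  fixes N K :: nat and \<nu> :: "nat \<Rightarrow> real" and \<alpha>\<^sub>1 :: real
  assumes "N \<ge> 1"
    and "\<forall>i\<in>{1..K}. 0 < \<nu> i \<and> \<nu> i < 1"
    and "\<alpha>\<^sub>1 > -1"
  shows "(\<forall>j\<in>{1..K - 1}.
            (\<forall>k\<in>{1..N}. \<forall>n\<in>{1..N}.
               set_integrable lborel {0<..}
                 (\<lambda>t. gal_fun1 0 n t * gal_fun2 (\<nu> (j + 1) - \<nu> 1) k t) \<and>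
               Q_mat N \<nu> j $$ (k - 1, n - 1) =
                 (LBINT t:{0<..}. exp (- t) * laguerre 0 (n - 1) t *
                    laguerre (\<nu> (j + 1) - \<nu> 1) (k - 1) t) \<and>
               Q_mat N \<nu> j $$ (k - 1, n - 1) =
                 (if n \<le> k
                  then 1 / fact (k - n) * (\<Prod>l = 1..k - n. \<nu> (j + 1) - \<nu> 1 + real l - 1)
                  else 0)) \<and>
            lower_triangular (Q_mat N \<nu> j) \<and> toeplitz (Q_mat N \<nu> j)) \<and>
         S_mat N K \<nu> \<alpha>\<^sub>1 = S_tilde N K \<nu> * D_mat N \<alpha>\<^sub>1 \<and>
         lower_triangular (S_tilde N K \<nu>) \<and> toeplitz (S_tilde N K \<nu>) \<and>
         diagonal_mat (D_mat N \<alpha>\<^sub>1) \<and>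
         (K = 2 \<longrightarrow> S_tilde N K \<nu> = 1\<^sub>m N + Q_mat N \<nu> 1) \<and>
         (K = 3 \<longrightarrow> S_tilde N K \<nu> = 1\<^sub>m N + Q_mat N \<nu> 1 + Q_mat N \<nu> 2)"
proof (intro conjI ballI)
  fix j k n assume "k \<in> {1..N}" "n \<in> {1..N}"
  then have kn: "1 \<le> k" "1 \<le> n" "k - 1 < N" "n - 1 < N" by auto
  let ?\<beta> = "\<nu> (j + 1) - \<nu> 1"
  show "set_integrable lborel {0<..} (\<lambda>t. gal_fun1 0 n t * gal_fun2 ?\<beta> k t)"
    using kn by (intro gal_fun_pairing)
  have Q: "Q_mat N \<nu> j $$ (k - 1, n - 1) = (LBINT t:{0<..}. gal_fun1 0 n t * gal_fun2 ?\<beta> k t)"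
    using kn by (simp add: Q_mat_def mat1_def)
  then show "Q_mat N \<nu> j $$ (k - 1, n - 1) =
      (LBINT t:{0<..}. exp (- t) * laguerre 0 (n - 1) t * laguerre ?\<beta> (k - 1) t)"
    by (simp only: LBINT_gal_fun_pairing)
  show "Q_mat N \<nu> j $$ (k - 1, n - 1) =
      (if n \<le> k then 1 / fact (k - n) * (\<Prod>l = 1..k - n. ?\<beta> + real l - 1) else 0)"
    using kn unfolding Q by (simp add: gal_fun_pairing pochhammer_conv_prod_1)
next
  fix j
  show "lower_triangular (Q_mat N \<nu> j)" "toeplitz (Q_mat N \<nu> j)"
    by (fact Q_mat_lower_triangular_toeplitz)+
next
  show "S_mat N K \<nu> \<alpha>\<^sub>1 = S_tilde N K \<nu> * D_mat N \<alpha>\<^sub>1"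
    by (rule S_mat_factorization)
  show "lower_triangular (S_tilde N K \<nu>)" "toeplitz (S_tilde N K \<nu>)"
    by (fact S_tilde_lower_triangular_toeplitz)+
  show "diagonal_mat (D_mat N \<alpha>\<^sub>1)"
    by (rule diagonal_D_mat)
  show "K = 2 \<longrightarrow> S_tilde N K \<nu> = 1\<^sub>m N + Q_mat N \<nu> 1"
    by (intro impI eq_matI) (simp_all add: S_tilde_index)
  show "K = 3 \<longrightarrow> S_tilde N K \<nu> = 1\<^sub>m N + Q_mat N \<nu> 1 + Q_mat N \<nu> 2"
    \<comment> \<open>Writing 2 as a successor lets the simplifier unroll the sum over j = 1,
      2.\<close>
    by (intro impI eq_matI) (simp_all add: S_tilde_index numeral_2_eq_2)
qed

end
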